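(* Let $F\colon\mathcal{W}\rightleftarrows\mathcal{V}\colon G$ (with $F$ left adjoint) be a weak monoidal Quillen adjunction between monoidal model categories. (1) If $\mathcal{V}_{\mathrm{loc}}$ is a monoidal left Bousfield localization of $\mathcal{V}$, then $F\colon\mathcal{W}\rightleftarrows\mathcal{V}_{\mathrm{loc}}\colon G$ is a weak monoidal Quillen adjunction. (2) If $\mathcal{W}_{\mathrm{coloc}}$ is a monoidal right Bousfield localization of $\mathcal{W}$ such that a cofibrant replacement $Q\mathbb{1}_{\mathcal{W}}$ of the tensor unit of $\mathcal{W}$ is also cofibrant in $\mathcal{W}_{\mathrm{coloc}}$, then $F\colon\mathcal{W}_{\mathrm{coloc}}\rightleftarrows\mathcal{V}\colon G$ is a weak monoidal Quillen adjunction.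
   Context: A monoidal model category is a model category with a closed monoidal structure $(\otimes,\mathbb{1})$ satisfying the pushout-product axiom (for cofibrations $i\colon a\to b$, $k\colon x\to y$, the map $(a\otimes y)\amalg_{a\otimes x}(b\otimes x)\to b\otimes y$ is a cofibration, acyclic if $i$ or $k$ is) and the unit axiom (for $x$ cofibrant and every cofibrant replacement $q\colon Q\mathbb{1}\to\mathbb{1}$, the map $x\otimes Q\mathbb{1}\to x\otimes\mathbb{1}\cong x$ is a weak equivalence). A weak monoidal Quillen adjunction is a Quillen adjunction $F\colon\mathcal{W}\rightleftarrows\mathcal{V}\colon G$ between monoidal model categories with a lax monoidal structure on $G$ such that for the corresponding oplax structure $\delta_{x,y}\colon F(x\otimes y)\to F(x)\otimes F(y)$, $\varepsilon\colon F(\mathbb{1}_{\mathcal{W}})\to\mathbb{1}_{\mathcal{V}}$ on $F$: (i) $\delta_{x,y}$ is a weak equivalence for all cofibrant $x,y\in\mathcal{W}$; (ii) for some (hence any) cofibrant replacement $q\colon Q\mathbb{1}_{\mathcal{W}}\to\mathbb{1}_{\mathcal{W}}$, the composite $\varepsilon\circ F(q)\colon F(Q\mathbb{1}_{\mathcal{W}})\to\mathbb{1}_{\mathcal{V}}$ is a weak equivalence. Let $\mathcal{C}$ be a model category with weak equivalences $W$, fibrations $\mathrm{Fib}$, cofibrations $\mathrm{Cof}$. A left Bousfield localization of $\mathcal{C}$ is another model structure $(W',\mathrm{Fib}',\mathrm{Cof}')$ on the same category with $W\subseteq W'$ and $\mathrm{Cof}=\mathrm{Cof}'$. A right Bousfield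 localization is another model structure with $W\subseteq W'$ and $\mathrm{Fib}=\mathrm{Fib}'$. A (left or right) Bousfield localization of a monoidal model category $\mathcal{V}$ is monoidal if it is also a monoidal model category with the same monoidal structure as $\mathcal{V}$. *)

theory Defs
  imports "HOL-Library.Equipollence" "HOL-Library.Infinite_Typeclass"
begin

section \<open>Categories, functors and adjunctions\<close>

record ('o, 'm) cat =
  Obj :: "'o set"
  Arr :: "'m set"
  Dom :: "'m \<Rightarrow> 'o"
  Cod :: "'m \<Rightarrow> 'o"
  Ide :: "'o \<Rightarrow> 'm"
  Comp :: "'m \<Rightarrow> 'm \<Rightarrow> 'm"  (infixr "\<cdot>\<index>" 70)

definition hom :: "('o, 'm, 'e) cat_scheme \<Rightarrow> 'o \<Rightarrow> 'o \<Rightarrow> 'm set" where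
  "hom C x y = {f \<in> Arr C. Dom C f = x \<and> Cod C f = y}"

locale category =
  fixes C :: "('o, 'm, 'e) cat_scheme" (structure)
  assumes dom_closed: "f \<in> Arr C \<Longrightarrow> Dom C f \<in> Obj C"
    and cod_closed: "f \<in> Arr C \<Longrightarrow> Cod C f \<in> Obj C"
    and ide_closed: "x \<in> Obj C \<Longrightarrow> Ide C x \<in> hom C x x"
    and comp_closed: "f \<in> hom C x y \<Longrightarrow> g \<in> hom C y z \<Longrightarrow> g \<cdot> f \<in> hom C x z"
    and comp_ide: "f \<in> hom C x y \<Longrightarrow> f \<cdot> Ide C x = f"
    and ide_comp: "f \<in> hom C x y \<Longrightarrow> Ide C y \<cdot> f = f"
    and comp_assoc:
      "f \<in> hom C w x \<Longrightarrow> g \<in> hom C x y \<Longrightarrow> h \<in> hom C y z \<Longrightarrow> (h \<cdot> g) \<cdot> f = h \<cdot> (g \<cdot> f)"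

definition isomorphism :: "('o, 'm, 'e) cat_scheme \<Rightarrow> 'm \<Rightarrow> bool" where
  "isomorphism C f \<longleftrightarrow> f \<in> Arr C \<and>
     (\<exists>g \<in> hom C (Cod C f) (Dom C f).
        g \<cdot>\<^bsub>C\<^esub> f = Ide C (Dom C f) \<and> f \<cdot>\<^bsub>C\<^esub> g = Ide C (Cod C f))"

record ('o, 'm, 'p, 'n) funct =
  omap :: "'o \<Rightarrow> 'p"
  amap :: "'m \<Rightarrow> 'n"

locale cat_functor = source: category C + target: category D
  for C :: "('o, 'm, 'e) cat_scheme" and D :: "('p, 'n, 'h) cat_scheme" +
  fixes F :: "('o, 'm, 'p, 'n) funct"
  assumes omap_closed: "x \<in> Obj C \<Longrightarrow> omap F x \<in> Obj D"
    and amap_closed: "f \<in> hom C x y \<Longrightarrow> amap F f \<in> hom D (omap F x) (omap F y)"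
    and amap_ide: "x \<in> Obj C \<Longrightarrow> amap F (Ide C x) = Ide D (omap F x)"
    and amap_comp: "f \<in> hom C x y \<Longrightarrow> g \<in> hom C y z \<Longrightarrow>
      amap F (g \<cdot>\<^bsub>C\<^esub> f) = amap F g \<cdot>\<^bsub>D\<^esub> amap F f"

text \<open>\<open>F\<close> is left adjoint to \<open>G\<close>, with unit \<open>\<eta>\<close> and counit \<open>\<kappa>\<close>.\<close>

locale adjunction = left: cat_functor C D F + right: cat_functor D C G
  for C :: "('o, 'm, 'e) cat_scheme" and D :: "('p, 'n, 'h) cat_scheme"
    and F :: "('o, 'm, 'p, 'n) funct" and G :: "('p, 'n, 'o, 'm) funct" +
  fixes \<eta> :: "'o \<Rightarrow> 'm" and \<kappa> :: "'p \<Rightarrow> 'n"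
  assumes unit_closed: "x \<in> Obj C \<Longrightarrow> \<eta> x \<in> hom C x (omap G (omap F x))"
    and counit_closed: "y \<in> Obj D \<Longrightarrow> \<kappa> y \<in> hom D (omap F (omap G y)) y"
    and unit_natural:
      "f \<in> hom C x x' \<Longrightarrow> amap G (amap F f) \<cdot>\<^bsub>C\<^esub> \<eta> x = \<eta> x' \<cdot>\<^bsub>C\<^esub> f"
    and counit_natural:
      "g \<in> hom D y y' \<Longrightarrow> g \<cdot>\<^bsub>D\<^esub> \<kappa> y = \<kappa> y' \<cdot>\<^bsub>D\<^esub> amap F (amap G g)"
    and triangle_left:
      "x \<in> Obj C \<Longrightarrow> \<kappa> (omap F x) \<cdot>\<^bsub>D\<^esub> amap F (\<eta> x) = Ide D (omap F x)"
    and triangle_right: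
      "y \<in> Obj D \<Longrightarrow> amap G (\<kappa> y) \<cdot>\<^bsub>C\<^esub> \<eta> (omap G y) = Ide C (omap G y)"

definition has_right_adjoint ::
  "('o, 'm, 'e) cat_scheme \<Rightarrow> ('p, 'n, 'h) cat_scheme \<Rightarrow> ('o, 'm, 'p, 'n) funct \<Rightarrow> bool" where
  "has_right_adjoint C D F \<longleftrightarrow> (\<exists>G \<eta> \<kappa>. adjunction C D F G \<eta> \<kappa>)"


section \<open>Limits and colimits\<close>

definition cone ::
  "('i, 'j, 'h) cat_scheme \<Rightarrow> ('o, 'm, 'e) cat_scheme \<Rightarrow> ('i, 'j, 'o, 'm) funct
   \<Rightarrow> 'o \<Rightarrow> ('i \<Rightarrow> 'm) \<Rightarrow> bool" where
  "cone J C D x \<xi> \<longleftrightarrow> x \<in> Obj C \<and> (\<forall>j \<in> Obj J. \<xi> j \<in> hom C x (omap D j)) \<and>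
     (\<forall>a \<in> Arr J. amap D a \<cdot>\<^bsub>C\<^esub> \<xi> (Dom J a) = \<xi> (Cod J a))"

definition is_limit ::
  "('i, 'j, 'h) cat_scheme \<Rightarrow> ('o, 'm, 'e) cat_scheme \<Rightarrow> ('i, 'j, 'o, 'm) funct
   \<Rightarrow> 'o \<Rightarrow> ('i \<Rightarrow> 'm) \<Rightarrow> bool" where
  "is_limit J C D l \<pi> \<longleftrightarrow> cone J C D l \<pi> \<and>
     (\<forall>x \<xi>. cone J C D x \<xi> \<longrightarrow> (\<exists>!u. u \<in> hom C x l \<and> (\<forall>j \<in> Obj J. \<pi> j \<cdot>\<^bsub>C\<^esub> u = \<xi> j)))"

definition cocone ::
  "('i, 'j, 'h) cat_scheme \<Rightarrow> ('o, 'm, 'e) cat_scheme \<Rightarrow> ('i, 'j, 'o, 'm) funct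
   \<Rightarrow> 'o \<Rightarrow> ('i \<Rightarrow> 'm) \<Rightarrow> bool" where
  "cocone J C D x \<xi> \<longleftrightarrow> x \<in> Obj C \<and> (\<forall>j \<in> Obj J. \<xi> j \<in> hom C (omap D j) x) \<and>
     (\<forall>a \<in> Arr J. \<xi> (Cod J a) \<cdot>\<^bsub>C\<^esub> amap D a = \<xi> (Dom J a))"

definition is_colimit ::
  "('i, 'j, 'h) cat_scheme \<Rightarrow> ('o, 'm, 'e) cat_scheme \<Rightarrow> ('i, 'j, 'o, 'm) funct
   \<Rightarrow> 'o \<Rightarrow> ('i \<Rightarrow> 'm) \<Rightarrow> bool" where
  "is_colimit J C D l \<iota> \<longleftrightarrow> cocone J C D l \<iota> \<and>
     (\<forall>x \<xi>. cocone J C D x \<xi> \<longrightarrow> (\<exists>!u. u \<in> hom C l x \<and> (\<forall>j \<in> Obj J. u \<cdot>\<^bsub>C\<^esub> \<iota> j = \<xi> j)))"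

text \<open>
  Smallness is relative to a type \<open>'s\<close> playing the role of the universe: a category is small
  if it has strictly fewer arrows than \<open>'s\<close> has elements. Up to isomorphism, all such
  categories have objects and arrows in \<open>'s\<close>. If the cardinality of \<open>'s\<close> is inaccessible, this
  is smallness in the corresponding Grothendieck universe; if \<open>'s\<close> is countable, the small
  categories are the finite ones, as in Quillen's original axioms.
\<close>

definition small_complete :: "'s itself \<Rightarrow> ('o, 'm, 'e) cat_scheme \<Rightarrow> bool" where
  "small_complete U C \<longleftrightarrow>
     (\<forall>(J :: ('s, 's) cat) D. category J \<and> Arr J \<prec> (UNIV :: 's set) \<and> cat_functor J C D
        \<longrightarrow> (\<exists>l \<pi>. is_limit J C D l \<pi>))"

definition small_cocomplete :: "'s itself \<Rightarrow> ('o, 'm, 'e) cat_scheme \<Rightarrow> bool" where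
  "small_cocomplete U C \<longleftrightarrow>
     (\<forall>(J :: ('s, 's) cat) D. category J \<and> Arr J \<prec> (UNIV :: 's set) \<and> cat_functor J C D
        \<longrightarrow> (\<exists>l \<iota>. is_colimit J C D l \<iota>))"

definition initial :: "('o, 'm, 'e) cat_scheme \<Rightarrow> 'o \<Rightarrow> bool" where
  "initial C z \<longleftrightarrow> z \<in> Obj C \<and> (\<forall>x \<in> Obj C. \<exists>!f. f \<in> hom C z x)"

text \<open>\<open>p\<close> and \<open>q\<close> are the two legs, into the pushout object, of a pushout of the span
  formed by \<open>f\<close> and \<open>g\<close>.\<close>

definition is_pushout :: "('o, 'm, 'e) cat_scheme \<Rightarrow> 'm \<Rightarrow> 'm \<Rightarrow> 'm \<Rightarrow> 'm \<Rightarrow> bool" where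
  "is_pushout C f g p q \<longleftrightarrow>
     f \<in> Arr C \<and> g \<in> Arr C \<and> Dom C f = Dom C g \<and>
     p \<in> hom C (Cod C f) (Cod C p) \<and> q \<in> hom C (Cod C g) (Cod C p) \<and>
     p \<cdot>\<^bsub>C\<^esub> f = q \<cdot>\<^bsub>C\<^esub> g \<and>
     (\<forall>x. \<forall>u \<in> hom C (Cod C f) x. \<forall>v \<in> hom C (Cod C g) x. u \<cdot>\<^bsub>C\<^esub> f = v \<cdot>\<^bsub>C\<^esub> g \<longrightarrow>
        (\<exists>!h. h \<in> hom C (Cod C p) x \<and> h \<cdot>\<^bsub>C\<^esub> p = u \<and> h \<cdot>\<^bsub>C\<^esub> q = v))"


section \<open>Model categories\<close>

record 'm model =
  weq :: "'m set"
  fib :: "'m set"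
  cof :: "'m set"

definition retract_of :: "('o, 'm, 'e) cat_scheme \<Rightarrow> 'm \<Rightarrow> 'm \<Rightarrow> bool" where
  "retract_of C f g \<longleftrightarrow> f \<in> Arr C \<and> g \<in> Arr C \<and>
     (\<exists>s \<in> hom C (Dom C f) (Dom C g). \<exists>r \<in> hom C (Dom C g) (Dom C f).
      \<exists>s' \<in> hom C (Cod C f) (Cod C g). \<exists>r' \<in> hom C (Cod C g) (Cod C f).
        r \<cdot>\<^bsub>C\<^esub> s = Ide C (Dom C f) \<and> r' \<cdot>\<^bsub>C\<^esub> s' = Ide C (Cod C f) \<and>
        g \<cdot>\<^bsub>C\<^esub> s = s' \<cdot>\<^bsub>C\<^esub> f \<and> f \<cdot>\<^bsub>C\<^esub> r = r' \<cdot>\<^bsub>C\<^esub> g)"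

definition lifts_against :: "('o, 'm, 'e) cat_scheme \<Rightarrow> 'm \<Rightarrow> 'm \<Rightarrow> bool" where
  "lifts_against C i p \<longleftrightarrow>
     (\<forall>u \<in> hom C (Dom C i) (Dom C p). \<forall>v \<in> hom C (Cod C i) (Cod C p).
        p \<cdot>\<^bsub>C\<^esub> u = v \<cdot>\<^bsub>C\<^esub> i \<longrightarrow>
        (\<exists>h \<in> hom C (Cod C i) (Dom C p). h \<cdot>\<^bsub>C\<^esub> i = u \<and> p \<cdot>\<^bsub>C\<^esub> h = v))"

locale model_category = category C
  for U :: "'s::infinite itself" and C :: "('o, 'm, 'e) cat_scheme" (structure) +
  fixes M :: "'m model"
  assumes complete: "small_complete U C"
    and cocomplete: "small_cocomplete U C"
    and weq_Arr: "weq M \<subseteq> Arr C"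
    and fib_Arr: "fib M \<subseteq> Arr C"
    and cof_Arr: "cof M \<subseteq> Arr C"
    and two_of_three:
      "f \<in> hom C x y \<Longrightarrow> g \<in> hom C y z \<Longrightarrow> f \<in> weq M \<Longrightarrow> g \<in> weq M \<Longrightarrow> g \<cdot> f \<in> weq M"
      "f \<in> hom C x y \<Longrightarrow> g \<in> hom C y z \<Longrightarrow> f \<in> weq M \<Longrightarrow> g \<cdot> f \<in> weq M \<Longrightarrow> g \<in> weq M"
      "f \<in> hom C x y \<Longrightarrow> g \<in> hom C y z \<Longrightarrow> g \<in> weq M \<Longrightarrow> g \<cdot> f \<in> weq M \<Longrightarrow> f \<in> weq M"
    and retract:
      "retract_of C f g \<Longrightarrow> g \<in> weq M \<Longrightarrow> f \<in> weq M"
      "retract_of C f g \<Longrightarrow> g \<in> fib M \<Longrightarrow> f \<in> fib M"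
      "retract_of C f g \<Longrightarrow> g \<in> cof M \<Longrightarrow> f \<in> cof M"
    and lifting:
      "i \<in> cof M \<Longrightarrow> p \<in> fib M \<inter> weq M \<Longrightarrow> lifts_against C i p"
      "i \<in> cof M \<inter> weq M \<Longrightarrow> p \<in> fib M \<Longrightarrow> lifts_against C i p"
    and factorization:
      "f \<in> hom C x y \<Longrightarrow>
        \<exists>z. \<exists>i \<in> hom C x z. \<exists>p \<in> hom C z y. i \<in> cof M \<and> p \<in> fib M \<inter> weq M \<and> f = p \<cdot> i"
      "f \<in> hom C x y \<Longrightarrow>
        \<exists>z. \<exists>i \<in> hom C x z. \<exists>p \<in> hom C z y. i \<in> cof M \<inter> weq M \<and> p \<in> fib M \<and> f = p \<cdot> i"

definition cofibrant :: "('o, 'm, 'e) cat_scheme \<Rightarrow> 'm model \<Rightarrow> 'o \<Rightarrow> bool" where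
  "cofibrant C M x \<longleftrightarrow> (\<exists>z f. initial C z \<and> f \<in> hom C z x \<and> f \<in> cof M)"

definition cofibrant_replacement ::
  "('o, 'm, 'e) cat_scheme \<Rightarrow> 'm model \<Rightarrow> 'o \<Rightarrow> 'm \<Rightarrow> bool" where
  "cofibrant_replacement C M x q \<longleftrightarrow>
     q \<in> hom C (Dom C q) x \<and> cofibrant C M (Dom C q) \<and> q \<in> weq M"

definition left_bousfield_localization ::
  "'s::infinite itself \<Rightarrow> ('o, 'm, 'e) cat_scheme \<Rightarrow> 'm model \<Rightarrow> 'm model \<Rightarrow> bool" where
  "left_bousfield_localization U C M M' \<longleftrightarrow>
     model_category U C M \<and> model_category U C M' \<and> weq M \<subseteq> weq M' \<and> cof M = cof M'"

definition right_bousfield_localization ::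
  "'s::infinite itself \<Rightarrow> ('o, 'm, 'e) cat_scheme \<Rightarrow> 'm model \<Rightarrow> 'm model \<Rightarrow> bool" where
  "right_bousfield_localization U C M M' \<longleftrightarrow>
     model_category U C M \<and> model_category U C M' \<and> weq M \<subseteq> weq M' \<and> fib M = fib M'"

locale quillen_adjunction = adjunction C D F G \<eta> \<kappa> +
  source: model_category U C M + target: model_category U D N
  for U :: "'s::infinite itself"
    and C :: "('o, 'm, 'e) cat_scheme" and M :: "'m model"
    and D :: "('p, 'n, 'h) cat_scheme" and N :: "'n model"
    and F :: "('o, 'm, 'p, 'n) funct" and G :: "('p, 'n, 'o, 'm) funct"
    and \<eta> :: "'o \<Rightarrow> 'm" and \<kappa> :: "'p \<Rightarrow> 'n" +
  assumes left_cof: "f \<in> cof M \<Longrightarrow> amap F f \<in> cof N"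
    and left_acyclic_cof: "f \<in> cof M \<inter> weq M \<Longrightarrow> amap F f \<in> cof N \<inter> weq N"


section \<open>Monoidal categories and monoidal model categories\<close>

record ('o, 'm) moncat = "('o, 'm) cat" +
  Tensor :: "'o \<Rightarrow> 'o \<Rightarrow> 'o"  (infixr "\<otimes>\<index>" 75)
  TensorArr :: "'m \<Rightarrow> 'm \<Rightarrow> 'm"  (infixr "\<boxtimes>\<index>" 75)
  Unit :: "'o"  ("\<one>\<index>")
  Assoc :: "'o \<Rightarrow> 'o \<Rightarrow> 'o \<Rightarrow> 'm"
  Lunit :: "'o \<Rightarrow> 'm"
  Runit :: "'o \<Rightarrow> 'm"

text \<open>\<open>\<otimes>\<close> is the tensor product on objects, \<open>\<boxtimes>\<close> the tensor product on arrows.\<close>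

locale monoidal_category = category C
  for C :: "('o, 'm, 'e) moncat_scheme" (structure) +
  assumes tensor_closed: "x \<in> Obj C \<Longrightarrow> y \<in> Obj C \<Longrightarrow> x \<otimes> y \<in> Obj C"
    and tensor_arr_closed: "f \<in> hom C x x' \<Longrightarrow> g \<in> hom C y y' \<Longrightarrow>
      f \<boxtimes> g \<in> hom C (x \<otimes> y) (x' \<otimes> y')"
    and tensor_ide: "x \<in> Obj C \<Longrightarrow> y \<in> Obj C \<Longrightarrow> Ide C x \<boxtimes> Ide C y = Ide C (x \<otimes> y)"
    and tensor_comp: "f \<in> hom C x x' \<Longrightarrow> f' \<in> hom C x' x'' \<Longrightarrow>
      g \<in> hom C y y' \<Longrightarrow> g' \<in> hom C y' y'' \<Longrightarrow>
      (f' \<cdot> f) \<boxtimes> (g' \<cdot> g) = (f' \<boxtimes> g') \<cdot> (f \<boxtimes> g)"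
    and unit_object: "\<one> \<in> Obj C"
    and assoc_closed: "x \<in> Obj C \<Longrightarrow> y \<in> Obj C \<Longrightarrow> z \<in> Obj C \<Longrightarrow>
      Assoc C x y z \<in> hom C ((x \<otimes> y) \<otimes> z) (x \<otimes> (y \<otimes> z))"
    and assoc_iso: "x \<in> Obj C \<Longrightarrow> y \<in> Obj C \<Longrightarrow> z \<in> Obj C \<Longrightarrow> isomorphism C (Assoc C x y z)"
    and assoc_natural: "f \<in> hom C x x' \<Longrightarrow> g \<in> hom C y y' \<Longrightarrow> h \<in> hom C z z' \<Longrightarrow>
      Assoc C x' y' z' \<cdot> ((f \<boxtimes> g) \<boxtimes> h) = (f \<boxtimes> (g \<boxtimes> h)) \<cdot> Assoc C x y z"
    and lunit_closed: "x \<in> Obj C \<Longrightarrow> Lunit C x \<in> hom C (\<one> \<otimes> x) x"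
    and lunit_iso: "x \<in> Obj C \<Longrightarrow> isomorphism C (Lunit C x)"
    and lunit_natural: "f \<in> hom C x y \<Longrightarrow> Lunit C y \<cdot> (Ide C \<one> \<boxtimes> f) = f \<cdot> Lunit C x"
    and runit_closed: "x \<in> Obj C \<Longrightarrow> Runit C x \<in> hom C (x \<otimes> \<one>) x"
    and runit_iso: "x \<in> Obj C \<Longrightarrow> isomorphism C (Runit C x)"
    and runit_natural: "f \<in> hom C x y \<Longrightarrow> Runit C y \<cdot> (f \<boxtimes> Ide C \<one>) = f \<cdot> Runit C x"
    and pentagon: "w \<in> Obj C \<Longrightarrow> x \<in> Obj C \<Longrightarrow> y \<in> Obj C \<Longrightarrow> z \<in> Obj C \<Longrightarrow>
      (Ide C w \<boxtimes> Assoc C x y z) \<cdot> Assoc C w (x \<otimes> y) z \<cdot> (Assoc C w x y \<boxtimes> Ide C z) =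
      Assoc C w x (y \<otimes> z) \<cdot> Assoc C (w \<otimes> x) y z"
    and triangle: "x \<in> Obj C \<Longrightarrow> y \<in> Obj C \<Longrightarrow>
      (Ide C x \<boxtimes> Lunit C y) \<cdot> Assoc C x \<one> y = Runit C x \<boxtimes> Ide C y"

text \<open>No symmetry is assumed, so closedness is required on both sides.\<close>

locale closed_monoidal_category = monoidal_category C
  for C :: "('o, 'm, 'e) moncat_scheme" (structure) +
  assumes closed_right: "y \<in> Obj C \<Longrightarrow>
      has_right_adjoint C C \<lparr>omap = (\<lambda>x. x \<otimes> y), amap = (\<lambda>f. f \<boxtimes> Ide C y)\<rparr>"
    and closed_left: "x \<in> Obj C \<Longrightarrow>
      has_right_adjoint C C \<lparr>omap = (\<lambda>y. x \<otimes> y), amap = (\<lambda>g. Ide C x \<boxtimes> g)\<rparr>"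

text \<open>In the pushout-product axiom, \<open>s\<close> and \<open>t\<close> are the two legs of the pushout
  of \<open>a \<otimes> y\<close> and \<open>b \<otimes> x\<close> under \<open>a \<otimes> x\<close>, and \<open>h\<close> is the induced map to \<open>b \<otimes> y\<close>.\<close>

locale monoidal_model_category = closed_monoidal_category C + model_category U C M
  for U :: "'s::infinite itself" and C :: "('o, 'm, 'e) moncat_scheme" (structure)
    and M :: "'m model" +
  assumes pushout_product:
      "i \<in> hom C a b \<Longrightarrow> i \<in> cof M \<Longrightarrow> k \<in> hom C x y \<Longrightarrow> k \<in> cof M \<Longrightarrow>
       is_pushout C (Ide C a \<boxtimes> k) (i \<boxtimes> Ide C x) s t \<Longrightarrow>
       h \<in> hom C (Cod C s) (b \<otimes> y) \<Longrightarrow> h \<cdot> s = i \<boxtimes> Ide C y \<Longrightarrow> h \<cdot> t = Ide C b \<boxtimes> k \<Longrightarrow>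
       h \<in> cof M \<and> (i \<in> weq M \<or> k \<in> weq M \<longrightarrow> h \<in> weq M)"
    and unit_axiom:
      "cofibrant C M x \<Longrightarrow> cofibrant_replacement C M \<one> q \<Longrightarrow>
       Runit C x \<cdot> (Ide C x \<boxtimes> q) \<in> weq M"

definition monoidal_left_bousfield_localization ::
  "'s::infinite itself \<Rightarrow> ('o, 'm, 'e) moncat_scheme \<Rightarrow> 'm model \<Rightarrow> 'm model \<Rightarrow> bool" where
  "monoidal_left_bousfield_localization U C M M' \<longleftrightarrow>
     left_bousfield_localization U C M M' \<and> monoidal_model_category U C M'"

definition monoidal_right_bousfield_localization ::
  "'s::infinite itself \<Rightarrow> ('o, 'm, 'e) moncat_scheme \<Rightarrow> 'm model \<Rightarrow> 'm model \<Rightarrow> bool" where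
  "monoidal_right_bousfield_localization U C M M' \<longleftrightarrow>
     right_bousfield_localization U C M M' \<and> monoidal_model_category U C M'"


section \<open>Weak monoidal Quillen adjunctions\<close>

locale lax_monoidal_functor =
  source: monoidal_category V + target: monoidal_category W + cat_functor V W G
  for V :: "('p, 'n, 'h) moncat_scheme" and W :: "('o, 'm, 'e) moncat_scheme"
    and G :: "('p, 'n, 'o, 'm) funct" +
  fixes \<mu> :: "'p \<Rightarrow> 'p \<Rightarrow> 'm" and \<nu> :: "'m"
  assumes lax_tensor_closed: "x \<in> Obj V \<Longrightarrow> y \<in> Obj V \<Longrightarrow>
      \<mu> x y \<in> hom W (omap G x \<otimes>\<^bsub>W\<^esub> omap G y) (omap G (x \<otimes>\<^bsub>V\<^esub> y))"
    and lax_unit_closed: "\<nu> \<in> hom W \<one>\<^bsub>W\<^esub> (omap G \<one>\<^bsub>V\<^esub>)"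
    and lax_tensor_natural: "f \<in> hom V x x' \<Longrightarrow> g \<in> hom V y y' \<Longrightarrow>
      \<mu> x' y' \<cdot>\<^bsub>W\<^esub> (amap G f \<boxtimes>\<^bsub>W\<^esub> amap G g) = amap G (f \<boxtimes>\<^bsub>V\<^esub> g) \<cdot>\<^bsub>W\<^esub> \<mu> x y"
    and lax_assoc: "x \<in> Obj V \<Longrightarrow> y \<in> Obj V \<Longrightarrow> z \<in> Obj V \<Longrightarrow>
      amap G (Assoc V x y z) \<cdot>\<^bsub>W\<^esub> \<mu> (x \<otimes>\<^bsub>V\<^esub> y) z \<cdot>\<^bsub>W\<^esub> (\<mu> x y \<boxtimes>\<^bsub>W\<^esub> Ide W (omap G z)) =
      \<mu> x (y \<otimes>\<^bsub>V\<^esub> z) \<cdot>\<^bsub>W\<^esub> (Ide W (omap G x) \<boxtimes>\<^bsub>W\<^esub> \<mu> y z)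
        \<cdot>\<^bsub>W\<^esub> Assoc W (omap G x) (omap G y) (omap G z)"
    and lax_lunit: "x \<in> Obj V \<Longrightarrow>
      amap G (Lunit V x) \<cdot>\<^bsub>W\<^esub> \<mu> \<one>\<^bsub>V\<^esub> x \<cdot>\<^bsub>W\<^esub> (\<nu> \<boxtimes>\<^bsub>W\<^esub> Ide W (omap G x)) = Lunit W (omap G x)"
    and lax_runit: "x \<in> Obj V \<Longrightarrow>
      amap G (Runit V x) \<cdot>\<^bsub>W\<^esub> \<mu> x \<one>\<^bsub>V\<^esub> \<cdot>\<^bsub>W\<^esub> (Ide W (omap G x) \<boxtimes>\<^bsub>W\<^esub> \<nu>) = Runit W (omap G x)"

text \<open>
  The oplax structure on the left adjoint \<open>F\<close> corresponding to a lax structure \<open>\<mu>\<close>, \<open>\<nu>\<close> on the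
  right adjoint \<open>G\<close>: the adjuncts of
  \<open>x \<otimes> y \<rightarrow> G(F x) \<otimes> G(F y) \<rightarrow> G(F x \<otimes> F y)\<close> and of \<open>\<nu>\<close>.
\<close>

definition oplax_tensor ::
  "('o, 'm, 'e) moncat_scheme \<Rightarrow> ('p, 'n, 'h) moncat_scheme \<Rightarrow> ('o, 'm, 'p, 'n) funct
   \<Rightarrow> ('o \<Rightarrow> 'm) \<Rightarrow> ('p \<Rightarrow> 'n) \<Rightarrow> ('p \<Rightarrow> 'p \<Rightarrow> 'm) \<Rightarrow> 'o \<Rightarrow> 'o \<Rightarrow> 'n" where
  "oplax_tensor W V F \<eta> \<kappa> \<mu> x y =
     \<kappa> (omap F x \<otimes>\<^bsub>V\<^esub> omap F y) \<cdot>\<^bsub>V\<^esub>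
       amap F (\<mu> (omap F x) (omap F y) \<cdot>\<^bsub>W\<^esub> (\<eta> x \<boxtimes>\<^bsub>W\<^esub> \<eta> y))"

definition oplax_unit ::
  "('p, 'n, 'h) moncat_scheme \<Rightarrow> ('o, 'm, 'p, 'n) funct \<Rightarrow> ('p \<Rightarrow> 'n) \<Rightarrow> 'm \<Rightarrow> 'n" where
  "oplax_unit V F \<kappa> \<nu> = \<kappa> \<one>\<^bsub>V\<^esub> \<cdot>\<^bsub>V\<^esub> amap F \<nu>"

locale weak_monoidal_quillen_adjunction =
  source: monoidal_model_category U W M + target: monoidal_model_category U V N +
  quillen_adjunction U W M V N F G \<eta> \<kappa> + lax_monoidal_functor V W G \<mu> \<nu>
  for U :: "'s::infinite itself"
    and W :: "('o, 'm, 'e) moncat_scheme" and M :: "'m model"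
    and V :: "('p, 'n, 'h) moncat_scheme" and N :: "'n model"
    and F :: "('o, 'm, 'p, 'n) funct" and G :: "('p, 'n, 'o, 'm) funct"
    and \<eta> :: "'o \<Rightarrow> 'm" and \<kappa> :: "'p \<Rightarrow> 'n"
    and \<mu> :: "'p \<Rightarrow> 'p \<Rightarrow> 'm" and \<nu> :: "'m" +
  assumes oplax_tensor_weq: "cofibrant W M x \<Longrightarrow> cofibrant W M y \<Longrightarrow>
      oplax_tensor W V F \<eta> \<kappa> \<mu> x y \<in> weq N"
    and oplax_unit_weq: "\<exists>q. cofibrant_replacement W M \<one>\<^bsub>W\<^esub> q \<and>
      oplax_unit V F \<kappa> \<nu> \<cdot>\<^bsub>V\<^esub> amap F q \<in> weq N"

end

theory Submission
  imports Defs
begin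

text \<open>
  Enlarging the weak equivalences of the target while keeping its cofibrations visibly preserves
  every condition on a weak monoidal Quillen adjunction, so the statement on left localizations
  is immediate.

  For a right localization, lifting properties carry the argument. In a model category the
  (acyclic) cofibrations are exactly the arrows with the left lifting property against the acyclic
  fibrations (resp. the fibrations). Keeping the fibrations and enlarging the weak equivalences
  therefore imposes more lifting conditions on the cofibrations and the same ones on the acyclic
  cofibrations, so neither class grows (\<open>right_bousfield_cof_subset\<close>, \<open>right_bousfield_acyclic_cof_subset\<close>). Hence the
  adjunction remains Quillen, and there are no new cofibrant objects on which \<open>\<delta>\<close> has to be a
  weak equivalence.

  The unit condition is the only subtle point. It is known for some cofibrant replacement of the
  unit, which need not be cofibrant after localization, and it has to be transferred to the given
  replacement that is. This is the independence of the unit condition of the chosen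
  replacement (\<open>cofibrant_replacement_independence\<close>). Two cofibrant replacements of
  one object are connected through a third by weak equivalences between cofibrant objects, and
  a left Quillen functor preserves such weak equivalences by Ken Brown's lemma
  (\<open>ken_brown\<close>).
\<close>

section \<open>Lifting characterizations of cofibrations\<close>

lemma (in category) homD: "f \<in> hom C x y \<Longrightarrow> f \<in> Arr C \<and> Dom C f = x \<and> Cod C f = y"
  by (simp add: hom_def)

lemma (in category) hom_objs: "f \<in> hom C x y \<Longrightarrow> x \<in> Obj C \<and> y \<in> Obj C"
  using dom_closed cod_closed by (auto simp: hom_def)

lemma (in category) lifts_against_obtain:
  assumes "lifts_against C i p" "i \<in> hom C a b" "p \<in> hom C x y"
    "u \<in> hom C a x" "v \<in> hom C b y" "p \<cdot> u = v \<cdot> i"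
  obtains h where "h \<in> hom C b x" "h \<cdot> i = u" "p \<cdot> h = v"
  using assms unfolding lifts_against_def hom_def by auto

text \<open>
  The retract argument: a diagonal of the square with top \<open>i\<close> and bottom the identity is the
  section that exhibits \<open>f\<close> as a retract.
\<close>

lemma (in category) retract_of_factor:
  assumes i: "i \<in> hom C x z" and p: "p \<in> hom C z y" and f: "f = p \<cdot> i"
    and lift: "lifts_against C f p"
  shows "retract_of C f i"
proof -
  have fh: "f \<in> hom C x y"
    using f comp_closed i p by blast
  have y: "y \<in> Obj C" and x: "x \<in> Obj C"
    using hom_objs fh by auto
  have "p \<cdot> i = Ide C y \<cdot> f"
    using f ide_comp fh by simp
  with lifts_against_obtain[OF lift fh p i ide_closed[OF y]]
  obtain h where h: "h \<in> hom C y z" "h \<cdot> f = i" "p \<cdot> h = Ide C y"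
    by metis
  have I: "Ide C x \<in> hom C x x"
    using x by (rule ide_closed)
  have "i \<cdot> Ide C x = h \<cdot> f" "f \<cdot> Ide C x = p \<cdot> i" "Ide C x \<cdot> Ide C x = Ide C x"
    using h(2) f comp_ide[OF i] comp_ide[OF fh] comp_ide[OF I] by simp_all
  then show ?thesis
    using h I p homD[OF fh] homD[OF i] unfolding retract_of_def by metis
qed

context model_category
begin

lemma cof_if_lifts:
  assumes f: "f \<in> Arr C" and lift: "\<And>p. p \<in> fib M \<inter> weq M \<Longrightarrow> lifts_against C f p"
  shows "f \<in> cof M"
proof -
  have "f \<in> hom C (Dom C f) (Cod C f)"
    using f by (simp add: hom_def)
  from factorization(1)[OF this] obtain z i p where
    "i \<in> hom C (Dom C f) z" "p \<in> hom C z (Cod C f)" "i \<in> cof M" "p \<in> fib M \<inter> weq M" "f = p \<cdot> i"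
    by blast
  with retract_of_factor[of i _ z p _ f] lift[of p] retract(3)[of f i] show ?thesis by blast
qed

lemma acyclic_cof_if_lifts:
  assumes f: "f \<in> Arr C" and lift: "\<And>p. p \<in> fib M \<Longrightarrow> lifts_against C f p"
  shows "f \<in> cof M \<inter> weq M"
proof -
  have "f \<in> hom C (Dom C f) (Cod C f)"
    using f by (simp add: hom_def)
  from factorization(2)[OF this] obtain z i p where
    "i \<in> hom C (Dom C f) z" "p \<in> hom C z (Cod C f)" "i \<in> cof M \<inter> weq M" "p \<in> fib M" "f = p \<cdot> i"
    by blast
  with retract_of_factor[of i _ z p _ f] lift[of p] retract(1,3)[of f i] show ?thesis by blast
qed

lemma cof_comp:
  assumes f: "f \<in> hom C x y" "f \<in> cof M" and g: "g \<in> hom C y z" "g \<in> cof M"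
  shows "g \<cdot> f \<in> cof M"
proof (rule cof_if_lifts)
  have gf: "g \<cdot> f \<in> hom C x z"
    using comp_closed f g by blast
  then show "g \<cdot> f \<in> Arr C" by (simp add: hom_def)
  fix p assume p: "p \<in> fib M \<inter> weq M"
  define c d where "c = Dom C p" and "d = Cod C p"
  have ph: "p \<in> hom C c d"
    using p fib_Arr by (auto simp: hom_def c_def d_def)
  have "\<exists>h \<in> hom C z c. h \<cdot> g \<cdot> f = u \<and> p \<cdot> h = v"
    if u: "u \<in> hom C x c" and v: "v \<in> hom C z d" and sq: "p \<cdot> u = v \<cdot> g \<cdot> f" for u v
  proof -
    have vg: "v \<cdot> g \<in> hom C y d"
      using comp_closed g v by blast
    have "p \<cdot> u = (v \<cdot> g) \<cdot> f"
      using sq comp_assoc f g v by simp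
    then obtain k where k: "k \<in> hom C y c" "k \<cdot> f = u" "p \<cdot> k = v \<cdot> g"
      using lifts_against_obtain[OF lifting(1)[OF f(2) p] f(1) ph u vg] by blast
    then obtain h where h: "h \<in> hom C z c" "h \<cdot> g = k" "p \<cdot> h = v"
      using lifts_against_obtain[OF lifting(1)[OF g(2) p] g(1) ph k(1) v] by blast
    then have "h \<cdot> g \<cdot> f = u"
      using comp_assoc[OF f(1) g(1) h(1)] k by simp
    with h show ?thesis by blast
  qed
  then show "lifts_against C (g \<cdot> f) p"
    using gf homD unfolding lifts_against_def c_def d_def by auto
qed

text \<open>An identity is a retract of either factor of any factorization of it.\<close>

lemma ide_weq:
  assumes x: "x \<in> Obj C"
  shows "Ide C x \<in> weq M"
proof -
  have I: "Ide C x \<in> hom C x x"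
    using x by (rule ide_closed)
  from factorization(1)[OF I] obtain z i p where
    ip: "i \<in> hom C x z" "p \<in> hom C z x" "p \<in> fib M \<inter> weq M" "Ide C x = p \<cdot> i"
    by blast
  have "Ide C x \<cdot> Ide C x = Ide C x"
    using ide_comp[OF I] .
  then have "retract_of C (Ide C x) p"
    using I ip homD[OF I] homD[OF ip(2)] unfolding retract_of_def by metis
  with ip(3) retract(1) show ?thesis by blast
qed

lemma cofibrant_lift:
  assumes x: "cofibrant C M x" and p: "p \<in> fib M \<inter> weq M" "p \<in> hom C a b" and v: "v \<in> hom C x b"
  obtains h where "h \<in> hom C x a" "p \<cdot> h = v"
proof -
  from x obtain z f where z: "initial C z" and f: "f \<in> hom C z x" "f \<in> cof M"
    unfolding cofibrant_def by blast
  have "a \<in> Obj C" "b \<in> Obj C"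
    using p hom_objs by auto
  with z obtain u where u: "u \<in> hom C z a" and uniq: "\<exists>!w. w \<in> hom C z b"
    unfolding initial_def by blast
  have "p \<cdot> u = v \<cdot> f"
    using uniq comp_closed[OF u p(2)] comp_closed[OF f(1) v] by blast
  with lifts_against_obtain[OF lifting(1)[OF f(2) p(1)] f(1) p(2) u v] that show thesis by blast
qed

lemma cofibrant_cod:
  assumes x: "cofibrant C M x" and i: "i \<in> hom C x y" "i \<in> cof M"
  shows "cofibrant C M y"
proof -
  from x obtain z f where f: "initial C z" "f \<in> hom C z x" "f \<in> cof M"
    unfolding cofibrant_def by blast
  with cof_comp[OF f(2,3) i] comp_closed[OF f(2) i(1)] show ?thesis
    unfolding cofibrant_def by blast
qed

end


section \<open>Binary coproducts\<close>

definition is_coproduct :: "('o, 'm, 'e) cat_scheme \<Rightarrow> 'o \<Rightarrow> 'o \<Rightarrow> 'o \<Rightarrow> 'm \<Rightarrow> 'm \<Rightarrow> bool" where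
  "is_coproduct C a b c i j \<longleftrightarrow> i \<in> hom C a c \<and> j \<in> hom C b c \<and>
     (\<forall>x. \<forall>u \<in> hom C a x. \<forall>v \<in> hom C b x. \<exists>!h. h \<in> hom C c x \<and> h \<cdot>\<^bsub>C\<^esub> i = u \<and> h \<cdot>\<^bsub>C\<^esub> j = v)"

lemma is_coproduct_commute: "is_coproduct C a b c i j \<Longrightarrow> is_coproduct C b a c j i"
  unfolding is_coproduct_def by meson

lemma is_coproduct_unique:
  assumes "is_coproduct C a b c i j" "u \<in> hom C a x" "v \<in> hom C b x"
    and "h \<in> hom C c x" "h \<cdot>\<^bsub>C\<^esub> i = u" "h \<cdot>\<^bsub>C\<^esub> j = v"
    and "k \<in> hom C c x" "k \<cdot>\<^bsub>C\<^esub> i = u" "k \<cdot>\<^bsub>C\<^esub> j = v"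
  shows "h = k"
  using assms unfolding is_coproduct_def by metis

text \<open>
  A binary coproduct is a colimit over a discrete category with two objects. Since the universe
  type is infinite, it has two distinct elements to serve as these objects, and the resulting
  finite category is small.
\<close>

lemma (in model_category) coproduct_exists:
  assumes a: "a \<in> Obj C" and b: "b \<in> Obj C"
  obtains c i j where "is_coproduct C a b c i j"
proof -
  obtain s t :: 's where st: "t \<noteq> s"
    using arb_element[of "{undefined :: 's}"] by auto
  define J :: "('s, 's) cat" where
    "J = \<lparr>Obj = {s, t}, Arr = {s, t}, Dom = id, Cod = id, Ide = id, Comp = (\<lambda>g f. f)\<rparr>"
  define X where "X = (\<lambda>r. if r = s then a else b)"
  define D :: "('s, 's, 'o, 'm) funct" where "D = \<lparr>omap = X, amap = (\<lambda>r. Ide C (X r))\<rparr>"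
  have X: "X r \<in> Obj C" for r
    using a b by (simp add: X_def)
  have "category J"
    by unfold_locales (auto simp: J_def hom_def)
  moreover have "cat_functor J C D"
  proof (intro cat_functor.intro cat_functor_axioms.intro)
    show "category J" by fact
    show "category C" by unfold_locales
  qed (use X ide_closed ide_comp[OF ide_closed[OF X]] in \<open>auto simp: J_def D_def hom_def\<close>)
  moreover have "Arr J \<prec> (UNIV :: 's set)"
    by (rule finite_lesspoll_infinite[OF infinite_UNIV]) (simp add: J_def)
  ultimately obtain c \<iota> where col: "is_colimit J C D c \<iota>"
    using cocomplete unfolding small_cocomplete_def by meson
  have "is_coproduct C a b c (\<iota> s) (\<iota> t)"
    unfolding is_coproduct_def
  proof (intro conjI allI ballI)
    show "\<iota> s \<in> hom C a c" "\<iota> t \<in> hom C b c"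
      using col st by (auto simp: is_colimit_def cocone_def J_def D_def X_def)
    fix x u v assume u: "u \<in> hom C a x" and v: "v \<in> hom C b x"
    define \<xi> where "\<xi> = (\<lambda>r. if r = s then u else v)"
    have "cocone J C D x \<xi>"
      using u v st hom_objs[OF u] comp_ide[OF u] comp_ide[OF v]
      by (auto simp: cocone_def J_def D_def X_def \<xi>_def)
    then have "\<exists>!h. h \<in> hom C c x \<and> (\<forall>r \<in> Obj J. h \<cdot> \<iota> r = \<xi> r)"
      using col unfolding is_colimit_def by blast
    then show "\<exists>!h. h \<in> hom C c x \<and> h \<cdot> \<iota> s = u \<and> h \<cdot> \<iota> t = v"
      using st by (simp add: J_def \<xi>_def)
  qed
  then show thesis by (rule that)
qed

text \<open>
  The left inclusion of \<open>a\<close> is a pushout of the cofibration from the initial object to the other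
  summand, so lifts against it are assembled from the given map on \<open>a\<close> and a lift on \<open>b\<close>.
\<close>

lemma (in model_category) coproduct_inclusion_cof:
  assumes cop: "is_coproduct C a b c i j" and b: "cofibrant C M b"
  shows "i \<in> cof M"
proof (rule cof_if_lifts)
  have i: "i \<in> hom C a c" and j: "j \<in> hom C b c"
    using cop by (auto simp: is_coproduct_def)
  then show "i \<in> Arr C" by (simp add: hom_def)
  fix p assume p: "p \<in> fib M \<inter> weq M"
  define d e where "d = Dom C p" and "e = Cod C p"
  have ph: "p \<in> hom C d e"
    using p fib_Arr by (auto simp: hom_def d_def e_def)
  have "\<exists>h \<in> hom C c d. h \<cdot> i = u \<and> p \<cdot> h = v"
    if u: "u \<in> hom C a d" and v: "v \<in> hom C c e" and sq: "p \<cdot> u = v \<cdot> i" for u v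
  proof -
    obtain w where w: "w \<in> hom C b d" "p \<cdot> w = v \<cdot> j"
      using cofibrant_lift[OF b p ph comp_closed[OF j v]] by blast
    obtain h where h: "h \<in> hom C c d" "h \<cdot> i = u" "h \<cdot> j = w"
      using cop u w(1) unfolding is_coproduct_def by meson
    have "p \<cdot> h = v"
    proof (rule is_coproduct_unique[OF cop comp_closed[OF i v] comp_closed[OF j v]])
      show "p \<cdot> h \<in> hom C c e" using comp_closed h ph by blast
      show "(p \<cdot> h) \<cdot> i = v \<cdot> i" using comp_assoc[OF i h(1) ph] h sq by simp
      show "(p \<cdot> h) \<cdot> j = v \<cdot> j" using comp_assoc[OF j h(1) ph] h w by simp
    qed (use v in auto)
    with h show ?thesis by blast
  qed
  then show "lifts_against C i p"
    using i homD unfolding lifts_against_def d_def e_def by auto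
qed


section \<open>Ken Brown's lemma and the unit condition\<close>

lemma (in model_category) cofibrant_obj: "cofibrant C M x \<Longrightarrow> x \<in> Obj C"
  using hom_objs unfolding cofibrant_def by blast

text \<open>
  Ken Brown's factorization, obtained by factoring the map from the coproduct of \<open>x\<close> and \<open>y\<close>
  to \<open>y\<close> given by \<open>f\<close> and the identity. A left Quillen functor need not preserve
  the acyclic fibration \<open>p\<close>, but it preserves the acyclic cofibration \<open>k\<close>, and the equation
  for \<open>p \<cdot> k\<close> then forces the image of \<open>p\<close> to be a weak equivalence.
\<close>

lemma (in model_category) ken_brown_factorization:
  assumes x: "cofibrant C M x" and y: "cofibrant C M y" and f: "f \<in> hom C x y" "f \<in> weq M"
  obtains z j k p where "j \<in> hom C x z" "j \<in> cof M \<inter> weq M" "k \<in> hom C y z" "k \<in> cof M \<inter> weq M"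
    "p \<in> hom C z y" "p \<cdot> j = f" "p \<cdot> k = Ide C y"
proof -
  have yo: "y \<in> Obj C" and xo: "x \<in> Obj C"
    using x y cofibrant_obj by auto
  obtain c i i' where cop: "is_coproduct C x y c i i'"
    using coproduct_exists[OF xo yo] .
  then have i: "i \<in> hom C x c" and i': "i' \<in> hom C y c"
    by (auto simp: is_coproduct_def)
  obtain g where g: "g \<in> hom C c y" "g \<cdot> i = f" "g \<cdot> i' = Ide C y"
    using cop f(1) ide_closed[OF yo] unfolding is_coproduct_def by meson
  from factorization(1)[OF g(1)] obtain z l p where
    l: "l \<in> hom C c z" "l \<in> cof M" and p: "p \<in> hom C z y" "p \<in> fib M \<inter> weq M" and gpl: "g = p \<cdot> l"
    by blast
  have li: "l \<cdot> i \<in> hom C x z" and li': "l \<cdot> i' \<in> hom C y z"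
    using comp_closed i i' l by blast+
  have pli: "p \<cdot> l \<cdot> i = f" and pli': "p \<cdot> l \<cdot> i' = Ide C y"
    using g gpl comp_assoc[OF i l(1) p(1)] comp_assoc[OF i' l(1) p(1)] by auto
  have "l \<cdot> i \<in> cof M"
    using cof_comp[OF i _ l] coproduct_inclusion_cof[OF cop y] by blast
  moreover have "l \<cdot> i' \<in> cof M"
    using cof_comp[OF i' _ l] coproduct_inclusion_cof[OF is_coproduct_commute[OF cop] x] by blast
  moreover have "l \<cdot> i \<in> weq M"
    using two_of_three(3)[OF li p(1)] p(2) pli f(2) by simp
  moreover have "l \<cdot> i' \<in> weq M"
    using two_of_three(3)[OF li' p(1)] p(2) pli' ide_weq[OF yo] by simp
  ultimately show thesis
    using that li li' p(1) pli pli' by blast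
qed

context quillen_adjunction
begin

lemma ken_brown:
  assumes x: "cofibrant C M x" and y: "cofibrant C M y" and f: "f \<in> hom C x y" "f \<in> weq M"
  shows "amap F f \<in> weq N"
proof -
  obtain z j k p where
    j: "j \<in> hom C x z" "j \<in> cof M \<inter> weq M" and k: "k \<in> hom C y z" "k \<in> cof M \<inter> weq M"
    and p: "p \<in> hom C z y" and pj: "p \<cdot>\<^bsub>C\<^esub> j = f" and pk: "p \<cdot>\<^bsub>C\<^esub> k = Ide C y"
    using source.ken_brown_factorization[OF x y f] .
  have Fj: "amap F j \<in> weq N" and Fk: "amap F k \<in> weq N"
    using left_acyclic_cof j k by auto
  note Fh = left.amap_closed[OF j(1)] left.amap_closed[OF k(1)] left.amap_closed[OF p]
  have y: "y \<in> Obj C"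
    using y source.cofibrant_obj by blast
  have "amap F p \<cdot>\<^bsub>D\<^esub> amap F k = Ide D (omap F y)"
    using left.amap_comp[OF k(1) p] pk left.amap_ide[OF y] by simp
  then have "amap F p \<in> weq N"
    using target.two_of_three(2)[OF Fh(2,3) Fk] target.ide_weq left.omap_closed y by simp
  then show ?thesis
    using target.two_of_three(1)[OF Fh(1,3) Fj] left.amap_comp[OF j(1) p] pj by simp
qed

text \<open>
  Replacing \<open>q\<close> by an acyclic fibration \<open>p\<close> with cofibrant domain allows \<open>q\<^sub>0\<close> to be lifted through
  it. Both replacements then factor through \<open>p\<close> by weak equivalences between cofibrant objects,
  which \<open>F\<close> preserves, so both conditions are equivalent to the one for \<open>p\<close>.
\<close>

lemma cofibrant_replacement_independence:
  assumes q0: "cofibrant_replacement C M x q\<^sub>0" and q: "cofibrant_replacement C M x q"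
    and e: "e \<in> hom D (omap F x) y" and weq: "e \<cdot>\<^bsub>D\<^esub> amap F q\<^sub>0 \<in> weq N"
  shows "e \<cdot>\<^bsub>D\<^esub> amap F q \<in> weq N"
proof -
  obtain a where a: "q\<^sub>0 \<in> hom C a x" "cofibrant C M a" "q\<^sub>0 \<in> weq M"
    using q0 unfolding cofibrant_replacement_def by blast
  obtain b where b: "q \<in> hom C b x" "cofibrant C M b" "q \<in> weq M"
    using q unfolding cofibrant_replacement_def by blast
  from source.factorization(2)[OF b(1)] obtain z i p where
    i: "i \<in> hom C b z" "i \<in> cof M \<inter> weq M" and p: "p \<in> hom C z x" "p \<in> fib M"
    and qpi: "q = p \<cdot>\<^bsub>C\<^esub> i"
    by blast
  have z: "cofibrant C M z"
    using source.cofibrant_cod[OF b(2) i(1)] i(2) by blast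
  have pw: "p \<in> weq M"
    using source.two_of_three(2)[OF i(1) p(1)] i(2) b(3) qpi by blast
  with p(2) obtain h where h: "h \<in> hom C a z" "p \<cdot>\<^bsub>C\<^esub> h = q\<^sub>0"
    using source.cofibrant_lift[OF a(2) _ p(1) a(1)] by blast
  have hw: "h \<in> weq M"
    using source.two_of_three(3)[OF h(1) p(1) pw] h(2) a(3) by blast
  note Fh = left.amap_closed[OF h(1)] and Fi = left.amap_closed[OF i(1)]
    and Fp = left.amap_closed[OF p(1)]
  have ep: "e \<cdot>\<^bsub>D\<^esub> amap F p \<in> hom D (omap F z) y"
    using left.target.comp_closed[OF Fp e] .
  have "(e \<cdot>\<^bsub>D\<^esub> amap F p) \<cdot>\<^bsub>D\<^esub> amap F h = e \<cdot>\<^bsub>D\<^esub> amap F q\<^sub>0"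
    using left.target.comp_assoc[OF Fh Fp e] left.amap_comp[OF h(1) p(1)] h(2) by simp
  then have "e \<cdot>\<^bsub>D\<^esub> amap F p \<in> weq N"
    using target.two_of_three(2)[OF Fh ep] ken_brown[OF a(2) z h(1) hw] weq by simp
  moreover have "amap F i \<in> weq N"
    using left_acyclic_cof i(2) by blast
  moreover have "(e \<cdot>\<^bsub>D\<^esub> amap F p) \<cdot>\<^bsub>D\<^esub> amap F i = e \<cdot>\<^bsub>D\<^esub> amap F q"
    using left.target.comp_assoc[OF Fi Fp e] left.amap_comp[OF i(1) p(1)] qpi by simp
  ultimately show ?thesis
    using target.two_of_three(1)[OF Fi ep] by simp
qed

end


section \<open>Bousfield localizations\<close>

lemma right_bousfield_cof_subset:
  assumes "right_bousfield_localization U C M M'"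
  shows "cof M' \<subseteq> cof M"
proof
  interpret M: model_category U C M
    using assms by (simp add: right_bousfield_localization_def)
  interpret M': model_category U C M'
    using assms by (simp add: right_bousfield_localization_def)
  fix f assume "f \<in> cof M'"
  then show "f \<in> cof M"
    using M.cof_if_lifts M'.lifting(1) M'.cof_Arr assms
    unfolding right_bousfield_localization_def by blast
qed

lemma right_bousfield_acyclic_cof_subset:
  assumes "right_bousfield_localization U C M M'"
  shows "cof M' \<inter> weq M' \<subseteq> cof M \<inter> weq M"
proof
  interpret M: model_category U C M
    using assms by (simp add: right_bousfield_localization_def)
  interpret M': model_category U C M'
    using assms by (simp add: right_bousfield_localization_def)
  fix f assume f: "f \<in> cof M' \<inter> weq M'"
  show "f \<in> cof M \<inter> weq M"
  proof (rule M.acyclic_cof_if_lifts)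
    show "f \<in> Arr C" using f M'.cof_Arr by blast
    show "lifts_against C f p" if "p \<in> fib M" for p
      using that M'.lifting(2)[OF f] assms by (simp add: right_bousfield_localization_def)
  qed
qed

lemma cofibrant_mono: "cof M' \<subseteq> cof M \<Longrightarrow> cofibrant C M' x \<Longrightarrow> cofibrant C M x"
  unfolding cofibrant_def by blast

context weak_monoidal_quillen_adjunction
begin

lemma left_bousfield_weak_monoidal_quillen:
  assumes "monoidal_left_bousfield_localization U V N N'"
  shows "weak_monoidal_quillen_adjunction U W M V N' F G \<eta> \<kappa> \<mu> \<nu>"
proof -
  interpret N': monoidal_model_category U V N'
    using assms by (simp add: monoidal_left_bousfield_localization_def)
  have sub: "weq N \<subseteq> weq N'" and cof: "cof N = cof N'"
    using assms
    by (auto simp: monoidal_left_bousfield_localization_def left_bousfield_localization_def)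
  show ?thesis
  proof unfold_locales
    show "amap F f \<in> cof N'" if "f \<in> cof M" for f
      using left_cof that cof by blast
    show "amap F f \<in> cof N' \<inter> weq N'" if "f \<in> cof M \<inter> weq M" for f
      using left_acyclic_cof that cof sub by blast
    show "oplax_tensor W V F \<eta> \<kappa> \<mu> x y \<in> weq N'" if "cofibrant W M x" "cofibrant W M y" for x y
      using oplax_tensor_weq that sub by blast
    show "\<exists>q. cofibrant_replacement W M \<one>\<^bsub>W\<^esub> q \<and> oplax_unit V F \<kappa> \<nu> \<cdot>\<^bsub>V\<^esub> amap F q \<in> weq N'"
      using oplax_unit_weq sub by blast
  qed
qed

lemma oplax_unit_closed: "oplax_unit V F \<kappa> \<nu> \<in> hom V (omap F \<one>\<^bsub>W\<^esub>) \<one>\<^bsub>V\<^esub>"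
  unfolding oplax_unit_def
  using target.comp_closed[OF left.amap_closed[OF lax_unit_closed]
      counit_closed[OF target.unit_object]] .

lemma right_bousfield_weak_monoidal_quillen:
  assumes loc: "monoidal_right_bousfield_localization U W M M'"
    and q: "cofibrant_replacement W M \<one>\<^bsub>W\<^esub> q" "cofibrant W M' (Dom W q)"
  shows "weak_monoidal_quillen_adjunction U W M' V N F G \<eta> \<kappa> \<mu> \<nu>"
proof -
  interpret M': monoidal_model_category U W M'
    using loc by (simp add: monoidal_right_bousfield_localization_def)
  have rbl: "right_bousfield_localization U W M M'"
    using loc by (simp add: monoidal_right_bousfield_localization_def)
  note cof = right_bousfield_cof_subset[OF rbl]
    and acyclic = right_bousfield_acyclic_cof_subset[OF rbl]
  have "weq M \<subseteq> weq M'"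
    using rbl by (simp add: right_bousfield_localization_def)
  then have q': "cofibrant_replacement W M' \<one>\<^bsub>W\<^esub> q"
    using q unfolding cofibrant_replacement_def by (simp add: subsetD)
  show ?thesis
  proof unfold_locales
    show "amap F f \<in> cof N" if "f \<in> cof M'" for f
      using left_cof that cof by blast
    show "amap F f \<in> cof N \<inter> weq N" if "f \<in> cof M' \<inter> weq M'" for f
      using left_acyclic_cof that acyclic by blast
    show "oplax_tensor W V F \<eta> \<kappa> \<mu> x y \<in> weq N" if "cofibrant W M' x" "cofibrant W M' y" for x y
      by (rule oplax_tensor_weq[OF that[THEN cofibrant_mono[OF cof]]])
    show "\<exists>q. cofibrant_replacement W M' \<one>\<^bsub>W\<^esub> q \<and> oplax_unit V F \<kappa> \<nu> \<cdot>\<^bsub>V\<^esub> amap F q \<in> weq N"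
    proof -
      obtain q\<^sub>0 where "cofibrant_replacement W M \<one>\<^bsub>W\<^esub> q\<^sub>0"
        "oplax_unit V F \<kappa> \<nu> \<cdot>\<^bsub>V\<^esub> amap F q\<^sub>0 \<in> weq N"
        using oplax_unit_weq by blast
      from cofibrant_replacement_independence[OF this(1) q(1) oplax_unit_closed this(2)] q'
      show ?thesis by blast
    qed
  qed
qed

end

theorem corollary11p5:
  fixes U :: "'s::infinite itself"
    and W :: "('o, 'm) moncat" and V :: "('p, 'n) moncat"
    and M :: "'m model" and N :: "'n model"
    and F :: "('o, 'm, 'p, 'n) funct" and G :: "('p, 'n, 'o, 'm) funct"
    and \<eta> :: "'o \<Rightarrow> 'm" and \<kappa> :: "'p \<Rightarrow> 'n"
    and \<mu> :: "'p \<Rightarrow> 'p \<Rightarrow> 'm" and \<nu> :: "'m"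
  assumes "weak_monoidal_quillen_adjunction U W M V N F G \<eta> \<kappa> \<mu> \<nu>"
  shows "(\<forall>Nloc. monoidal_left_bousfield_localization U V N Nloc \<longrightarrow>
            weak_monoidal_quillen_adjunction U W M V Nloc F G \<eta> \<kappa> \<mu> \<nu>)
       \<and> (\<forall>Mcoloc. monoidal_right_bousfield_localization U W M Mcoloc \<and>
            (\<exists>q. cofibrant_replacement W M \<one>\<^bsub>W\<^esub> q \<and> cofibrant W Mcoloc (Dom W q)) \<longrightarrow>
            weak_monoidal_quillen_adjunction U W Mcoloc V N F G \<eta> \<kappa> \<mu> \<nu>)"
proof (intro conjI allI impI; (elim conjE exE)?)
  interpret weak_monoidal_quillen_adjunction U W M V N F G \<eta> \<kappa> \<mu> \<nu>
    by fact
  fix Nloc assume "monoidal_left_bousfield_localization U V N Nloc"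
  then show "weak_monoidal_quillen_adjunction U W M V Nloc F G \<eta> \<kappa> \<mu> \<nu>"
    by (rule left_bousfield_weak_monoidal_quillen)
next
  interpret weak_monoidal_quillen_adjunction U W M V N F G \<eta> \<kappa> \<mu> \<nu>
    by fact
  fix Mcoloc q
  assume "monoidal_right_bousfield_localization U W M Mcoloc"
    "cofibrant_replacement W M \<one>\<^bsub>W\<^esub> q" "cofibrant W Mcoloc (Dom W q)"
  then show "weak_monoidal_quillen_adjunction U W Mcoloc V N F G \<eta> \<kappa> \<mu> \<nu>"
    by (rule right_bousfield_weak_monoidal_quillen)
qed

end
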